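(* Let $\varphi\in L^2(\mathbb{R}^2,\mathbb{H})$ be a window function with $\|\varphi\|_2=1$ and let $f\in L^2(\mathbb{R}^2,\mathbb{H})$ with $\|f\|_2=1$. Let $\Sigma\subset\mathbb{R}^2\times\mathbb{R}^2$ be measurable and let $0\le\varepsilon<1$ be such that $$\int\int_{\Sigma}|\mathcal{G}_{\varphi}\{f\}(\omega,b)|^2\,d\omega\,db\ \geq\ 1-\varepsilon.$$ Then $m(\Sigma)\geq 1-\varepsilon$, where $m(\Sigma)$ is the Lebesgue measure of $\Sigma$.
   Context: $\mathbb{H}$ is the algebra of real quaternions with imaginary units $i,j,k$ ($i^2=j^2=k^2=ijk=-1$), conjugation $\overline{q}$ and modulus $|q|=\sqrt{q\overline{q}}$. $L^2(\mathbb{R}^2,\mathbb{H})$ is the space of measurable $f:\mathbb{R}^2\to\mathbb{H}$ with $\|f\|_2=\left(\int_{\mathbb{R}^2}|f(x)|^2dx\right)^{1/2}<\infty$. For $f,\varphi\in L^2(\mathbb{R}^2,\mathbb{H})$ with $\varphi\neq 0$ (the window), the two-sided Gabor quaternion Fourier transform (GQFT) of $f$ is $$\mathcal{G}_{\varphi}\{f\}(\omega,b)=\int_{\mathbb{R}^2}e^{-2\pi i x_1\omega_1}\,f(x)\,\overline{\varphi(x-b)}\,e^{-2\pi j x_2\omega_2}\,dx,\qquad \omega=(\omega_1,\omega_2),\ b\in\mathbb{R}^2.$$ *)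

theory Defs
  imports "HOL-Analysis.Analysis"
begin

section \<open>The normed division algebra of real quaternions\<close>

datatype quat = Quat (QRe: real) (QIm1: real) (QIm2: real) (QIm3: real)

lemma quat_eq_iff:
  "p = q \<longleftrightarrow> QRe p = QRe q \<and> QIm1 p = QIm1 q \<and> QIm2 p = QIm2 q \<and> QIm3 p = QIm3 q"
  by (cases p; cases q) simp

instantiation quat :: ring_1
begin

definition "0 = Quat 0 0 0 0"
definition "1 = Quat 1 0 0 0"
definition "- q = Quat (- QRe q) (- QIm1 q) (- QIm2 q) (- QIm3 q)"
definition "p + q = Quat (QRe p + QRe q) (QIm1 p + QIm1 q) (QIm2 p + QIm2 q) (QIm3 p + QIm3 q)"
definition "p - q = Quat (QRe p - QRe q) (QIm1 p - QIm1 q) (QIm2 p - QIm2 q) (QIm3 p - QIm3 q)"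
definition "p * q = Quat
  (QRe p * QRe q - QIm1 p * QIm1 q - QIm2 p * QIm2 q - QIm3 p * QIm3 q)
  (QRe p * QIm1 q + QIm1 p * QRe q + QIm2 p * QIm3 q - QIm3 p * QIm2 q)
  (QRe p * QIm2 q - QIm1 p * QIm3 q + QIm2 p * QRe q + QIm3 p * QIm1 q)
  (QRe p * QIm3 q + QIm1 p * QIm2 q - QIm2 p * QIm1 q + QIm3 p * QRe q)"

instance
  by standard
    (simp_all add: zero_quat_def one_quat_def uminus_quat_def plus_quat_def minus_quat_def
      times_quat_def algebra_simps)

end

lemma quat_sel_simps [simp]:
  "QRe 0 = 0" "QIm1 0 = 0" "QIm2 0 = 0" "QIm3 0 = 0"
  "QRe 1 = 1" "QIm1 1 = 0" "QIm2 1 = 0" "QIm3 1 = 0"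
  "QRe (- q) = - QRe q" "QIm1 (- q) = - QIm1 q" "QIm2 (- q) = - QIm2 q" "QIm3 (- q) = - QIm3 q"
  "QRe (p + q) = QRe p + QRe q" "QIm1 (p + q) = QIm1 p + QIm1 q"
  "QIm2 (p + q) = QIm2 p + QIm2 q" "QIm3 (p + q) = QIm3 p + QIm3 q"
  "QRe (p - q) = QRe p - QRe q" "QIm1 (p - q) = QIm1 p - QIm1 q"
  "QIm2 (p - q) = QIm2 p - QIm2 q" "QIm3 (p - q) = QIm3 p - QIm3 q"
  "QRe (p * q) = QRe p * QRe q - QIm1 p * QIm1 q - QIm2 p * QIm2 q - QIm3 p * QIm3 q"
  "QIm1 (p * q) = QRe p * QIm1 q + QIm1 p * QRe q + QIm2 p * QIm3 q - QIm3 p * QIm2 q"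
  "QIm2 (p * q) = QRe p * QIm2 q - QIm1 p * QIm3 q + QIm2 p * QRe q + QIm3 p * QIm1 q"
  "QIm3 (p * q) = QRe p * QIm3 q + QIm1 p * QIm2 q - QIm2 p * QIm1 q + QIm3 p * QRe q"
  by (simp_all add: zero_quat_def one_quat_def uminus_quat_def plus_quat_def minus_quat_def
      times_quat_def)

instantiation quat :: real_vector
begin

definition "r *\<^sub>R q = Quat (r * QRe q) (r * QIm1 q) (r * QIm2 q) (r * QIm3 q)"

instance
  by standard (simp_all add: quat_eq_iff scaleR_quat_def algebra_simps)

end

instantiation quat :: real_inner
begin

definition "inner p q = QRe p * QRe q + QIm1 p * QIm1 q + QIm2 p * QIm2 q + QIm3 p * QIm3 q"
definition "norm q = sqrt (inner q q)" for q :: quat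
definition "sgn q = q /\<^sub>R norm q" for q :: quat
definition "dist p q = norm (p - q)" for p q :: quat
definition
  "(uniformity :: (quat \<times> quat) filter) = (INF e\<in>{0<..}. principal {(x, y). dist x y < e})"
definition
  "open (U :: quat set) \<longleftrightarrow> (\<forall>x\<in>U. eventually (\<lambda>(x', y). x' = x \<longrightarrow> y \<in> U) uniformity)"

instance
proof
  fix p q r :: quat and a :: real
  show "inner p q = inner q p" "inner (p + q) r = inner p r + inner q r"
    "inner (a *\<^sub>R p) q = a * inner p q"
    by (simp_all add: inner_quat_def scaleR_quat_def algebra_simps)
  show "0 \<le> inner p p"
    by (simp add: inner_quat_def)
  show "inner p p = 0 \<longleftrightarrow> p = 0"
    by (auto simp: inner_quat_def quat_eq_iff add_nonneg_eq_0_iff)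
qed (rule norm_quat_def sgn_quat_def dist_quat_def uniformity_quat_def open_quat_def)+

end

lemma quat_sel_scaleR [simp]:
  "QRe (r *\<^sub>R q) = r * QRe q" "QIm1 (r *\<^sub>R q) = r * QIm1 q"
  "QIm2 (r *\<^sub>R q) = r * QIm2 q" "QIm3 (r *\<^sub>R q) = r * QIm3 q"
  by (simp_all add: scaleR_quat_def)

lemma norm_quat: "norm q = sqrt ((QRe q)\<^sup>2 + (QIm1 q)\<^sup>2 + (QIm2 q)\<^sup>2 + (QIm3 q)\<^sup>2)"
  by (simp add: norm_quat_def inner_quat_def power2_eq_square)

lemma four_square_identity:
  fixes a b c d e f g h :: real
  shows "(a * e - b * f - c * g - d * h)\<^sup>2 + (a * f + b * e + c * h - d * g)\<^sup>2 +
      (a * g - b * h + c * e + d * f)\<^sup>2 + (a * h + b * g - c * f + d * e)\<^sup>2 =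
    (a\<^sup>2 + b\<^sup>2 + c\<^sup>2 + d\<^sup>2) * (e\<^sup>2 + f\<^sup>2 + g\<^sup>2 + h\<^sup>2)"
  by algebra

instantiation quat :: real_normed_div_algebra
begin

definition "inverse q = Quat (QRe q) (- QIm1 q) (- QIm2 q) (- QIm3 q) /\<^sub>R (norm q)\<^sup>2"
definition "p div q = p * inverse q" for p q :: quat

instance
proof
  fix p q :: quat
  show scl: "a *\<^sub>R p * q = a *\<^sub>R (p * q)" and scr: "p * a *\<^sub>R q = a *\<^sub>R (p * q)"
    for a and p q :: quat
    by (simp_all add: quat_eq_iff algebra_simps)
  show "inverse (0 :: quat) = 0"
    by (simp add: inverse_quat_def quat_eq_iff)
  show "p div q = p * inverse q"
    by (rule divide_quat_def)
  show "norm (p * q) = norm p * norm q"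
    unfolding norm_quat real_sqrt_mult [symmetric]
    by (rule arg_cong [where f = sqrt]) (simp only: quat_sel_simps four_square_identity)
  assume "p \<noteq> 0"
  then have "(norm p)\<^sup>2 \<noteq> 0" by simp
  moreover define c where "c = Quat (QRe p) (- QIm1 p) (- QIm2 p) (- QIm3 p)"
  have "c * p = (norm p)\<^sup>2 *\<^sub>R 1" "p * c = (norm p)\<^sup>2 *\<^sub>R 1"
    by (simp_all add: c_def norm_quat quat_eq_iff power2_eq_square)
  ultimately show "inverse p * p = 1" "p * inverse p = 1"
    by (simp_all add: inverse_quat_def scl scr flip: c_def)
qed

end

definition quat_i :: quat where "quat_i = Quat 0 1 0 0"
definition quat_j :: quat where "quat_j = Quat 0 0 1 0"
definition quat_k :: quat where "quat_k = Quat 0 0 0 1"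

lemma quat_units:
  "quat_i\<^sup>2 = -1" "quat_j\<^sup>2 = -1" "quat_k\<^sup>2 = -1" "quat_i * quat_j * quat_k = -1"
  by (simp_all add: quat_eq_iff quat_i_def quat_j_def quat_k_def power2_eq_square)

instantiation quat :: euclidean_space
begin

definition "Basis = {1, quat_i, quat_j, quat_k}"

instance
proof
  show "(Basis :: quat set) \<noteq> {}" "finite (Basis :: quat set)"
    by (simp_all add: Basis_quat_def)
  show "inner u v = (if u = v then 1 else 0)" if "u \<in> Basis" "v \<in> Basis" for u v :: quat
    using that unfolding Basis_quat_def
    by (elim insertE emptyE)
      (simp_all add: inner_quat_def quat_i_def quat_j_def quat_k_def one_quat_def)
  show "(\<forall>u\<in>Basis. inner x u = 0) \<longleftrightarrow> x = 0" for x :: quat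
    by (cases x) (simp add: Basis_quat_def inner_quat_def quat_i_def quat_j_def quat_k_def
        zero_quat_def one_quat_def)
qed

end

definition quat_cnj :: "quat \<Rightarrow> quat" where
  "quat_cnj q = Quat (QRe q) (- QIm1 q) (- QIm2 q) (- QIm3 q)"

lemma quat_mult_cnj: "q * quat_cnj q = of_real ((norm q)\<^sup>2)"
  by (simp add: quat_eq_iff quat_cnj_def norm_quat of_real_def power2_eq_square)

lemma norm_quat_cnj: "norm q = sqrt (QRe (q * quat_cnj q))"
  by (simp add: quat_cnj_def norm_quat power2_eq_square)

section \<open>Square-integrable functions and the two-sided Gabor quaternion Fourier transform\<close>

text \<open>Elements of \<open>L\<^sup>2\<close> are represented by functions, not by classes modulo null sets.\<close>

definition L2_fun :: "(real^2 \<Rightarrow> quat) set" where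
  "L2_fun = {f \<in> borel_measurable lebesgue. integrable lebesgue (\<lambda>x. (norm (f x))\<^sup>2)}"

definition L2_nrm :: "(real^2 \<Rightarrow> quat) \<Rightarrow> real" where
  "L2_nrm f = sqrt (LINT x|lebesgue. (norm (f x))\<^sup>2)"

definition GQFT :: "(real^2 \<Rightarrow> quat) \<Rightarrow> (real^2 \<Rightarrow> quat) \<Rightarrow> real^2 \<Rightarrow> real^2 \<Rightarrow> quat" where
  "GQFT \<phi> f \<omega> b = (LINT x|lebesgue.
     exp ((- 2 * pi * x $ 1 * \<omega> $ 1) *\<^sub>R quat_i) * f x * quat_cnj (\<phi> (x - b)) *
     exp ((- 2 * pi * x $ 2 * \<omega> $ 2) *\<^sub>R quat_j))"

end

(* AM-GM applied to |f(x)| |phi(x - b)| and translation invariance give |G_phi f| <= 1 everywhere,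
   so the energy of G_phi f on a set never exceeds the measure of the set. *)
theory Submission
  imports Defs
begin

text \<open>Both exponential kernels are unit quaternions (\<open>norm_exp_imaginary_quat\<close>)
  and the quaternion norm is multiplicative, so the integrand of the transform has modulus |f(x)|
  |\<phi>(x - b)|. Bounding this product by half the sum of the squares and integrating, with
  translation invariance for the window, gives |G| \<le> 1 at every point
  (\<open>norm_GQFT_le\<close>). Hence the energy of G on \<Sigma> is at most the integral of the
  indicator of \<Sigma>, which is its measure.\<close>

lemma linear_quat_cnj: "linear quat_cnj"
  by (rule linearI) (simp_all add: quat_cnj_def quat_eq_iff)

lemma quat_cnj_mult: "quat_cnj (p * q) = quat_cnj q * quat_cnj p"
  by (simp add: quat_cnj_def quat_eq_iff algebra_simps)

lemma norm_cnj_quat: "norm (quat_cnj q) = norm q"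
  by (simp add: quat_cnj_def norm_quat)

lemma quat_cnj_power: "quat_cnj (q ^ n) = quat_cnj q ^ n"
proof (induction n)
  case 0
  show ?case
    by (simp add: quat_cnj_def quat_eq_iff)
next
  case (Suc n)
  \<comment> \<open>Conjugation reverses products, so the extra factor comes out on the right; hence
    the right-handed power rule.\<close>
  then show ?case
    unfolding power_Suc2 [of "quat_cnj q"] by (simp add: quat_cnj_mult)
qed

text \<open>A bounded linear map passes through the exponential series, and conjugation commutes
  with each power.\<close>

lemma quat_cnj_exp: "quat_cnj (exp q) = exp (quat_cnj q)"
proof -
  interpret bounded_linear quat_cnj
    using linear_quat_cnj by (rule linear_conv_bounded_linear [THEN iffD1])
  show ?thesis
    unfolding exp_def suminf [OF summable_exp_generic, symmetric]
    by (simp add: suminf [OF summable_exp_generic] scaleR quat_cnj_power)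
qed

text \<open>Conjugation negates a purely imaginary q, so |exp q|^2 = exp q * exp (- q) = 1.\<close>

lemma norm_exp_imaginary_quat:
  fixes q :: quat
  assumes "QRe q = 0"
  shows "norm (exp q) = 1"
proof -
  have "quat_cnj q = - q"
    using assms by (simp add: quat_cnj_def quat_eq_iff)
  then have "of_real ((norm (exp q))\<^sup>2) = (1 :: quat)"
    by (simp only: quat_mult_cnj [symmetric] quat_cnj_exp exp_minus_inverse)
  then have "(norm (exp q))\<^sup>2 = 1"
    by (simp only: of_real_eq_1_iff)
  then show ?thesis
    using norm_ge_zero [of "exp q"] unfolding power2_eq_1_iff by linarith
qed

text \<open>A translation is the affine map whose scale factors are all 1, so its Jacobian factor is
  1.\<close>

lemma lebesgue_distr_minus: "distr lebesgue lebesgue (\<lambda>x. x - b) = lebesgue"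
  for b :: "'a :: euclidean_space"
  using lebesgue_affine_euclidean [of "\<lambda>_. 1" "- b"]
  by (simp add: euclidean_representation density_1)

lemma measurable_lebesgue_minus: "(\<lambda>x. x - b) \<in> lebesgue \<rightarrow>\<^sub>M lebesgue"
  for b :: "'a :: euclidean_space"
  using lebesgue_affine_measurable [of "\<lambda>_. 1" "- b"]
  by (simp add: euclidean_representation)

lemma has_bochner_integral_lebesgue_minus:
  fixes g :: "'a :: euclidean_space \<Rightarrow> 'b :: {banach, second_countable_topology}"
  assumes "integrable lebesgue g"
  shows "has_bochner_integral lebesgue (\<lambda>x. g (x - b)) (integral\<^sup>L lebesgue g)"
  using assms integrable_distr_eq [OF measurable_lebesgue_minus, of g b]
    integral_distr [OF measurable_lebesgue_minus, of g b]
  by (simp add: has_bochner_integral_iff lebesgue_distr_minus borel_measurable_integrable)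

text \<open>The arithmetic-geometric mean inequality replaces Cauchy-Schwarz; for unit norms both
  give the bound 1, uniformly in \<omega> and b.\<close>

lemma norm_GQFT_le:
  assumes \<phi>: "\<phi> \<in> L2_fun" and f: "f \<in> L2_fun"
  shows "norm (GQFT \<phi> f \<omega> b) \<le> ((L2_nrm f)\<^sup>2 + (L2_nrm \<phi>)\<^sup>2) / 2"
proof -
  let ?G = "\<lambda>x. exp ((- 2 * pi * x $ 1 * \<omega> $ 1) *\<^sub>R quat_i) * f x * quat_cnj (\<phi> (x - b)) *
     exp ((- 2 * pi * x $ 2 * \<omega> $ 2) *\<^sub>R quat_j)"
  let ?B = "\<lambda>x. ((norm (f x))\<^sup>2 + (norm (\<phi> (x - b)))\<^sup>2) / 2"
  have G: "norm (?G x) = norm (f x) * norm (\<phi> (x - b))" for x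
    by (simp add: norm_mult norm_cnj_quat norm_exp_imaginary_quat quat_i_def quat_j_def)
  have "has_bochner_integral lebesgue (\<lambda>x. (norm (f x))\<^sup>2) ((L2_nrm f)\<^sup>2)"
    using f by (simp add: L2_fun_def L2_nrm_def has_bochner_integral_iff)
  moreover have "has_bochner_integral lebesgue (\<lambda>x. (norm (\<phi> (x - b)))\<^sup>2) ((L2_nrm \<phi>)\<^sup>2)"
    using \<phi> has_bochner_integral_lebesgue_minus [of "\<lambda>x. (norm (\<phi> x))\<^sup>2" b]
    by (simp add: L2_fun_def L2_nrm_def)
  ultimately have B: "has_bochner_integral lebesgue ?B (((L2_nrm f)\<^sup>2 + (L2_nrm \<phi>)\<^sup>2) / 2)"
    by (intro has_bochner_integral_divide_zero has_bochner_integral_add)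
  have "norm (GQFT \<phi> f \<omega> b) \<le> (LINT x|lebesgue. norm (?G x))"
    unfolding GQFT_def by (rule integral_norm_bound)
  \<comment> \<open>\<open>integral_mono'\<close> asks only for an integrable nonnegative majorant:
    a non-integrable left side would have integral 0 by convention.\<close>
  also have "\<dots> \<le> integral\<^sup>L lebesgue ?B"
  proof (rule integral_mono')
    show "norm (?G x) \<le> ?B x" for x
      using sum_squares_bound [of "norm (f x)" "norm (\<phi> (x - b))"] unfolding G by simp
  qed (use B in \<open>simp_all add: has_bochner_integral_iff\<close>)
  finally show ?thesis
    using B by (simp add: has_bochner_integral_iff)
qed

theorem theorem4p2:
  fixes \<phi> f :: "real^2 \<Rightarrow> quat" and \<Sigma> :: "((real^2) \<times> (real^2)) set" and \<epsilon> :: real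
  assumes "\<phi> \<in> L2_fun" and "L2_nrm \<phi> = 1"
    and "f \<in> L2_fun" and "L2_nrm f = 1"
    and "\<Sigma> \<in> sets lebesgue"
    and "0 \<le> \<epsilon>" and "\<epsilon> < 1"
    and "(\<integral>\<^sup>+(\<omega>, b)\<in>\<Sigma>. ennreal ((norm (GQFT \<phi> f \<omega> b))\<^sup>2) \<partial>lebesgue) \<ge> ennreal (1 - \<epsilon>)"
  shows "emeasure lebesgue \<Sigma> \<ge> ennreal (1 - \<epsilon>)"
proof -
  have "norm (GQFT \<phi> f \<omega> b) \<le> 1" for \<omega> b
    using norm_GQFT_le [OF assms(1,3)] assms(2,4) by simp
  then have "ennreal ((norm (GQFT \<phi> f \<omega> b))\<^sup>2) \<le> 1" for \<omega> b
    by (simp add: power_le_one)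
  \<comment> \<open>The nonnegative integral is monotone for arbitrary functions, so the pointwise
    bound suffices without joint measurability of the transform.\<close>
  then have "(\<integral>\<^sup>+(\<omega>, b)\<in>\<Sigma>. ennreal ((norm (GQFT \<phi> f \<omega> b))\<^sup>2) \<partial>lebesgue)
      \<le> (\<integral>\<^sup>+p. indicator \<Sigma> p \<partial>lebesgue)"
    by (intro nn_integral_mono) (auto split: prod.split split_indicator)
  also have "\<dots> = emeasure lebesgue \<Sigma>"
    using assms(5) by simp
  finally show ?thesis
    using assms(8) by (rule order_trans [rotated])
qed

end
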